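(* Let $(m_n)_{n\ge 1}$ be a sequence of positive integers with $m_n\to\infty$ as $n\to\infty$. For each $n\ge 1$ let $X_n$ be a random variable with values in $\{1,\ldots,m_n\}$ and $\mathbb{P}(X_n=i)=p_n(i)>0$ for $i=1,\ldots,m_n$, let $X_{n,1},\ldots,X_{n,n}$ be iid random variables with the same distribution as $X_n$, and let $\chi_n^2$ be the associated Pearson chi-square statistic. Assume that $$\frac{1}{m_n n}\,\mathrm{Var}\!\left(\frac{1}{p_n(X_n)}\right)\to 0\qquad\text{and}\qquad \frac{n}{\sqrt{m_n}}\to 0$$ as $n\to\infty$. Then, as $n\to\infty$, $$\frac{\chi_n^2-m_n}{\sqrt{2m_n}}\ \stackrel{d}{\to}\ 0.$$
   Context: The Pearson chi-square statistic is $$\chi_n^2=n\sum_{i=1}^{m_n}\frac{(\hat p_n(i)-p_n(i))^2}{p_n(i)},\qquad \hat p_n(i)=\frac1n\sum_{k=1}^n I(X_{n,k}=i),\quad i=1,\ldots,m_n,$$ where $I(\cdot)$ denotes the indicator of an event. The random variable $1/p_n(X_n)$ is the function $i\mapsto 1/p_n(i)$ evaluated at $X_n$. The symbol $\stackrel{d}{\to}$ denotes convergence in distribution (here to the constant $0$). *)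

theory Defs
  imports "HOL-Probability.Probability"
begin

definition empirical_freq :: "nat \<Rightarrow> (nat \<Rightarrow> 'a \<Rightarrow> nat) \<Rightarrow> nat \<Rightarrow> 'a \<Rightarrow> real" where
  "empirical_freq n Y i \<omega> = 1 / real n * (\<Sum>k=1..n. of_bool (Y k \<omega> = i))"

definition pearson_chi_square ::
  "nat \<Rightarrow> nat \<Rightarrow> (nat \<Rightarrow> real) \<Rightarrow> (nat \<Rightarrow> 'a \<Rightarrow> nat) \<Rightarrow> 'a \<Rightarrow> real" where
  "pearson_chi_square n m p Y \<omega> =
     real n * (\<Sum>i=1..m. (empirical_freq n Y i \<omega> - p i)\<^sup>2 / p i)"

end

(* Expanding the square, chi_n^2 = D + O - n, where D is the mean of the 1/p_n(X_{n,k}) and O is 1/n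
   times the sum of I(X_{n,k} = X_{n,l})/p_n(X_{n,k}) over k \<noteq> l.  Here D has mean m_n and variance
   Var(1/p_n(X_n))/n, while O is nonnegative with mean n - 1, so
     E|chi_n^2 - m_n| \<le> sqrt(Var(1/p_n(X_n))/n) + 2n.
   Under both hypotheses this is o(sqrt m_n), and convergence in L^1 implies convergence in law. *)
theory Submission
  imports Defs
begin

section \<open>From convergence in mean to convergence in law\<close>

text \<open>Weak convergence is convergence of the cdfs at continuity points of the limit. For the
  point mass at 0 these are the \<open>x\<close> other than 0, and there Markov's inequality at
  level \<open>\<bar>x\<bar>\<close> bounds the difference of the cdfs. The first two hypotheses are
  only eventual, so that they can be supplied from \<open>n \<ge> 1\<close> on.\<close>

lemma weak_conv_m_return_0_if_L1:
  fixes M :: "nat \<Rightarrow> 'a measure" and Z :: "nat \<Rightarrow> 'a \<Rightarrow> real"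
  assumes prob: "\<forall>\<^sub>F n in sequentially. prob_space (M n)"
    and int: "\<forall>\<^sub>F n in sequentially. integrable (M n) (Z n)"
    and L1: "(\<lambda>n. \<integral>\<omega>. \<bar>Z n \<omega>\<bar> \<partial>M n) \<longlonglongrightarrow> 0"
  shows "weak_conv_m (\<lambda>n. distr (M n) borel (Z n)) (return borel 0)"
proof -
  interpret R: prob_space "return borel (0::real)"
    by (rule prob_space_return) simp
  interpret R: real_distribution "return borel (0::real)"
    by standard auto
  have "(\<lambda>n. cdf (distr (M n) borel (Z n)) x) \<longlonglongrightarrow> cdf (return borel 0) x"
    if cont: "isCont (cdf (return borel 0)) x" for x :: real
  proof -
    \<comment> \<open>A cdf is continuous at \<open>x\<close> exactly when \<open>x\<close> is not
      an atom, and 0 is an atom of the limit.\<close>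
    have x0: "x \<noteq> 0"
      using cont by (auto simp: R.isCont_cdf measure_return)
    have bound: "\<forall>\<^sub>F n in sequentially.
        \<bar>cdf (distr (M n) borel (Z n)) x - cdf (return borel 0) x\<bar> \<le> (\<integral>\<omega>. \<bar>Z n \<omega>\<bar> \<partial>M n) / \<bar>x\<bar>"
      using prob int
    proof eventually_elim
      case (elim n)
      interpret P: prob_space "M n" by fact
      have Zm[measurable]: "Z n \<in> borel_measurable (M n)"
        using elim by auto
      have cdfZ: "cdf (distr (M n) borel (Z n)) x = P.prob {\<omega>\<in>space (M n). Z n \<omega> \<le> x}"
        unfolding cdf_def by (subst measure_distr) (auto intro!: arg_cong[where f = P.prob])
      have markov: "P.prob {\<omega>\<in>space (M n). \<bar>Z n \<omega>\<bar> \<ge> \<bar>x\<bar>} \<le> (\<integral>\<omega>. \<bar>Z n \<omega>\<bar> \<partial>M n) / \<bar>x\<bar>"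
        by (rule integral_Markov_inequality_measure[where A = "{}"]) (use elim x0 in auto)
      show ?case
      proof (cases "x < 0")
        case True
        \<comment> \<open>Left of 0 the limit cdf is 0, so the lower tail of \<open>Z n\<close> is
          the whole difference.\<close>
        have "P.prob {\<omega>\<in>space (M n). Z n \<omega> \<le> x} \<le> P.prob {\<omega>\<in>space (M n). \<bar>Z n \<omega>\<bar> \<ge> \<bar>x\<bar>}"
          using True by (intro P.finite_measure_mono) auto
        then show ?thesis
          using markov True by (simp add: cdfZ) (simp add: cdf_def measure_return indicator_def)
      next
        case False
        \<comment> \<open>Right of 0 the limit cdf is 1, so the difference is the upper tail, which
          again lies in the Markov event.\<close>
        have "1 - P.prob {\<omega>\<in>space (M n). Z n \<omega> \<le> x} = P.prob (space (M n) - {\<omega>\<in>space (M n). Z n \<omega> \<le> x})"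
          by (rule P.prob_compl[symmetric]) measurable
        also have "\<dots> \<le> P.prob {\<omega>\<in>space (M n). \<bar>Z n \<omega>\<bar> \<ge> \<bar>x\<bar>}"
          using False by (intro P.finite_measure_mono) auto
        finally show ?thesis
          using markov False P.prob_le_1[of "{\<omega>\<in>space (M n). Z n \<omega> \<le> x}"]
          by (simp add: cdfZ) (simp add: cdf_def measure_return indicator_def)
      qed
    qed
    have "(\<lambda>n. (\<integral>\<omega>. \<bar>Z n \<omega>\<bar> \<partial>M n) / \<bar>x\<bar>) \<longlonglongrightarrow> 0"
      using tendsto_divide[OF L1 tendsto_const[of "\<bar>x\<bar>"]] x0 by simp
    then have "(\<lambda>n. cdf (distr (M n) borel (Z n)) x - cdf (return borel 0) x) \<longlonglongrightarrow> 0"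
      by (rule Lim_null_comparison[rotated]) (use bound in simp)
    then show ?thesis
      by (simp add: LIM_zero_iff)
  qed
  then show ?thesis
    by (simp add: weak_conv_m_def weak_conv_def)
qed

section \<open>Moments of finite-valued variables and of independent sums\<close>

context prob_space
begin

text \<open>On a finite range every \<open>g\<close> is bounded. Reciprocals of cell probabilities
  and their squares thus become integrable at once.\<close>

lemma integrable_finite_valued:
  fixes g :: "'b \<Rightarrow> real"
  assumes "finite A" "Z \<in> measurable M (count_space A)"
  shows "integrable M (\<lambda>\<omega>. g (Z \<omega>))"
proof (rule integrable_const_bound)
  show "AE \<omega> in M. norm (g (Z \<omega>)) \<le> (\<Sum>i\<in>A. \<bar>g i\<bar>)"
    using measurable_space[OF assms(2)] assms(1)
    by (intro AE_I2) (auto intro!: member_le_sum[where f = "\<lambda>i. \<bar>g i\<bar>"])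
  show "random_variable borel (\<lambda>\<omega>. g (Z \<omega>))"
    by (rule measurable_compose[OF assms(2)]) simp
qed

lemma expectation_finite_valued:
  fixes g :: "'b \<Rightarrow> real"
  assumes A: "finite A" and Z: "Z \<in> measurable M (count_space A)"
  shows "expectation (\<lambda>\<omega>. g (Z \<omega>)) = (\<Sum>i\<in>A. g i * prob {\<omega>\<in>space M. Z \<omega> = i})"
proof -
  have meas: "{\<omega>\<in>space M. Z \<omega> = i} \<in> events" for i
  proof -
    \<comment> \<open>The value \<open>i\<close> may lie outside \<open>A\<close>; the event is then
      empty, and intersecting with \<open>A\<close> covers both cases.\<close>
    have "{\<omega>\<in>space M. Z \<omega> = i} = Z -` ({i} \<inter> A) \<inter> space M"
      using measurable_space[OF Z] by auto
    then show ?thesis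
      using measurable_sets[OF Z, of "{i} \<inter> A"] by simp
  qed
  have "expectation (\<lambda>\<omega>. g (Z \<omega>)) = expectation (\<lambda>\<omega>. \<Sum>i\<in>A. g i * indicator {\<omega>\<in>space M. Z \<omega> = i} \<omega>)"
  proof (rule Bochner_Integration.integral_cong)
    fix \<omega> assume \<omega>: "\<omega> \<in> space M"
    then have "Z \<omega> \<in> A"
      using measurable_space[OF Z] by simp
    then show "g (Z \<omega>) = (\<Sum>i\<in>A. g i * indicator {\<omega>\<in>space M. Z \<omega> = i} \<omega>)"
      using A \<omega> by (simp add: indicator_def of_bool_def[symmetric] sum.delta if_distrib cong: if_cong)
  qed simp
  also have "\<dots> = (\<Sum>i\<in>A. g i * prob {\<omega>\<in>space M. Z \<omega> = i})"
    using meas by (subst Bochner_Integration.integral_sum) (auto simp: less_top[symmetric])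
  finally show ?thesis .
qed

text \<open>Bienayme's identity, by induction: the new summand is independent of the sum of the
  others, so the mean of their product factors. Square integrability is part of the conclusion
  because the next induction step needs it for the partial sum.\<close>

lemma variance_sum_indep_vars:
  fixes Y :: "'i \<Rightarrow> 'a \<Rightarrow> real"
  assumes "finite I" "indep_vars (\<lambda>_. borel) Y I"
    and "\<And>i. i \<in> I \<Longrightarrow> integrable M (\<lambda>\<omega>. (Y i \<omega>)\<^sup>2)"
  shows "integrable M (\<lambda>\<omega>. (\<Sum>i\<in>I. Y i \<omega>)\<^sup>2) \<and>
    variance (\<lambda>\<omega>. \<Sum>i\<in>I. Y i \<omega>) = (\<Sum>i\<in>I. variance (Y i))"
  using assms
proof (induction I rule: finite_induct)
  case empty
  then show ?case by simp
next
  case (insert j I)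
  let ?S = "\<lambda>\<omega>. \<Sum>i\<in>I. Y i \<omega>"
  have IH: "integrable M (\<lambda>\<omega>. (?S \<omega>)\<^sup>2)" "variance ?S = (\<Sum>i\<in>I. variance (Y i))"
    using insert.IH[OF indep_vars_subset[OF insert.prems(1)]] insert.prems by auto
  have indep: "indep_var borel (Y j) borel ?S"
    by (rule indep_vars_sum[OF insert.hyps insert.prems(1)])
  have rv[measurable]: "random_variable borel (Y j)" "random_variable borel ?S"
    using indep by (auto dest: indep_var_rv1 indep_var_rv2)
  have sq: "integrable M (\<lambda>\<omega>. (Y j \<omega>)\<^sup>2)"
    using insert.prems by auto
  have int: "integrable M (Y j)" "integrable M ?S"
    using square_integrable_imp_integrable[OF rv(1) sq] square_integrable_imp_integrable[OF rv(2) IH(1)]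
    by simp_all
  have prod_int: "integrable M (\<lambda>\<omega>. Y j \<omega> * ?S \<omega>)"
    by (rule indep_var_integrable[OF indep int])
  have sq_sum: "(\<lambda>\<omega>. (\<Sum>i\<in>insert j I. Y i \<omega>)\<^sup>2) = (\<lambda>\<omega>. (Y j \<omega>)\<^sup>2 + (?S \<omega>)\<^sup>2 + 2 * (Y j \<omega> * ?S \<omega>))"
    using insert.hyps by (auto simp: power2_sum algebra_simps)
  have sq_int: "integrable M (\<lambda>\<omega>. (\<Sum>i\<in>insert j I. Y i \<omega>)\<^sup>2)"
    unfolding sq_sum using sq IH(1) prod_int
    by (intro Bochner_Integration.integrable_add integrable_mult_right)
  have E_sum: "expectation (\<lambda>\<omega>. \<Sum>i\<in>insert j I. Y i \<omega>) = expectation (Y j) + expectation ?S"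
    using insert.hyps int by simp
  have "expectation (\<lambda>\<omega>. (\<Sum>i\<in>insert j I. Y i \<omega>)\<^sup>2) =
      expectation (\<lambda>\<omega>. (Y j \<omega>)\<^sup>2) + expectation (\<lambda>\<omega>. (?S \<omega>)\<^sup>2) + 2 * (expectation (Y j) * expectation ?S)"
    unfolding sq_sum indep_var_lebesgue_integral[OF indep int, symmetric]
    using sq IH(1) prod_int by simp
  moreover have "integrable M (\<lambda>\<omega>. \<Sum>i\<in>insert j I. Y i \<omega>)"
    using insert.hyps int by simp
  \<comment> \<open>Twice the product of the two means occurs both in the second moment and in the
    squared mean, and cancels.\<close>
  ultimately have "variance (\<lambda>\<omega>. \<Sum>i\<in>insert j I. Y i \<omega>) = variance (Y j) + variance ?S"
    using sq_int int sq IH(1) by (subst (1 2 3) variance_eq) (simp_all only: E_sum, simp_all add: power2_sum)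
  then show ?case
    using sq_int IH(2) insert.hyps by simp
qed

text \<open>The variance of the absolute deviation is nonnegative, and it equals the variance of
  \<open>Z\<close> minus the square of the mean absolute deviation.\<close>

lemma expectation_abs_deviation_le:
  fixes Z :: "'a \<Rightarrow> real"
  assumes Z: "integrable M Z" and Z2: "integrable M (\<lambda>\<omega>. (Z \<omega>)\<^sup>2)"
  shows "expectation (\<lambda>\<omega>. \<bar>Z \<omega> - expectation Z\<bar>) \<le> sqrt (variance Z)"
proof (rule real_le_rsqrt)
  let ?W = "\<lambda>\<omega>. Z \<omega> - expectation Z"
  have "integrable M (\<lambda>\<omega>. (?W \<omega>)\<^sup>2)"
    using Z Z2 by (simp add: power2_diff)
  then have "variance (\<lambda>\<omega>. \<bar>?W \<omega>\<bar>) = variance Z - (expectation (\<lambda>\<omega>. \<bar>?W \<omega>\<bar>))\<^sup>2"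
    using Z by (subst variance_eq) auto
  then show "(expectation (\<lambda>\<omega>. \<bar>?W \<omega>\<bar>))\<^sup>2 \<le> variance Z"
    using variance_positive[of "\<lambda>\<omega>. \<bar>?W \<omega>\<bar>"] by simp
qed

end

section \<open>The chi-square statistic as a mean of reciprocals plus collisions\<close>

text \<open>A pointwise identity at a fixed \<open>\<omega>\<close>. Squared cell counts weighted by
  \<open>1 / p i\<close> count pairs of observations in the same cell; the diagonal pairs give the
  first sum, the others the double sum.\<close>

lemma pearson_chi_square_decomposition:
  fixes p :: "nat \<Rightarrow> real"
  assumes n: "n \<ge> 1" and p: "\<And>i. i \<in> {1..m} \<Longrightarrow> p i > 0" "(\<Sum>i=1..m. p i) = 1"
    and Y: "\<And>k. k \<in> {1..n} \<Longrightarrow> Y k \<omega> \<in> {1..m}"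
  shows "pearson_chi_square n m p Y \<omega> =
    (\<Sum>k=1..n. 1 / p (Y k \<omega>)) / real n
    + (\<Sum>k=1..n. \<Sum>l\<in>{1..n} - {k}. of_bool (Y k \<omega> = Y l \<omega>) / p (Y k \<omega>)) / real n - real n"
proof -
  \<comment> \<open>The number of observations in cell \<open>i\<close>, that is, \<open>n\<close>
    times the empirical frequency.\<close>
  define c :: "nat \<Rightarrow> real" where "c i = (\<Sum>k=1..n. of_bool (Y k \<omega> = i))" for i
  have sum_c: "(\<Sum>i=1..m. c i) = real n"
  proof -
    have "(\<Sum>i=1..m. c i) = (\<Sum>k=1..n. \<Sum>i=1..m. of_bool (Y k \<omega> = i))"
      unfolding c_def by (rule sum.swap)
    also have "\<dots> = (\<Sum>k=1..n. 1)"
      by (intro sum.cong refl) (use Y in \<open>auto simp: of_bool_def\<close>)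
    finally show ?thesis by simp
  qed
  have pick: "(\<Sum>i=1..m. of_bool (Y k \<omega> = i) * f i) = f (Y k \<omega>)" if "k \<in> {1..n}" for k and f :: "nat \<Rightarrow> real"
    using Y[OF that] by (simp add: of_bool_def if_distrib[of "\<lambda>x. x * _"] cong: if_cong)
  \<comment> \<open>Observation \<open>k\<close> always lies in its own cell, hence the 1; the
    remaining terms are its collisions.\<close>
  have c_Y: "c (Y k \<omega>) = 1 + (\<Sum>l\<in>{1..n} - {k}. of_bool (Y k \<omega> = Y l \<omega>))" if "k \<in> {1..n}" for k
  proof -
    have "c (Y k \<omega>) = 1 + (\<Sum>l\<in>{1..n} - {k}. of_bool (Y l \<omega> = Y k \<omega>))"
      unfolding c_def by (subst sum.remove[OF _ that]) simp_all
    also have "(\<Sum>l\<in>{1..n} - {k}. of_bool (Y l \<omega> = Y k \<omega>) :: real) =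
        (\<Sum>l\<in>{1..n} - {k}. of_bool (Y k \<omega> = Y l \<omega>))"
      by (intro sum.cong refl arg_cong[where f = of_bool]) (rule eq_commute)
    finally show ?thesis .
  qed
  \<comment> \<open>Only one of the two factors \<open>c i\<close> is expanded into indicators.
    Swapping the sums then turns a sum over cells into a sum over observations.\<close>
  have "(\<Sum>i=1..m. (c i)\<^sup>2 / p i) = (\<Sum>i=1..m. \<Sum>k=1..n. of_bool (Y k \<omega> = i) * (c i / p i))"
    by (intro sum.cong refl, unfold sum_distrib_right[symmetric] c_def[symmetric]) (simp add: power2_eq_square)
  also have "\<dots> = (\<Sum>k=1..n. c (Y k \<omega>) / p (Y k \<omega>))"
    by (subst sum.swap) (intro sum.cong refl pick)
  also have "\<dots> = (\<Sum>k=1..n. 1 / p (Y k \<omega>) + (\<Sum>l\<in>{1..n} - {k}. of_bool (Y k \<omega> = Y l \<omega>) / p (Y k \<omega>)))"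
    by (intro sum.cong refl) (simp only: c_Y add_divide_distrib sum_divide_distrib)
  finally have sq: "(\<Sum>i=1..m. (c i)\<^sup>2 / p i) = (\<Sum>k=1..n. 1 / p (Y k \<omega>))
      + (\<Sum>k=1..n. \<Sum>l\<in>{1..n} - {k}. of_bool (Y k \<omega> = Y l \<omega>) / p (Y k \<omega>))"
    by (simp add: sum.distrib)
  have "pearson_chi_square n m p Y \<omega> = real n * (\<Sum>i=1..m. (c i / real n - p i)\<^sup>2 / p i)"
    by (simp add: pearson_chi_square_def empirical_freq_def c_def)
  also have "(\<Sum>i=1..m. (c i / real n - p i)\<^sup>2 / p i) =
      (\<Sum>i=1..m. (c i)\<^sup>2 / p i / (real n)\<^sup>2 - 2 / real n * c i + p i)"
  proof (intro sum.cong refl)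
    fix i assume "i \<in> {1..m}"
    then have "p i > 0" by (rule p(1))
    then show "(c i / real n - p i)\<^sup>2 / p i = (c i)\<^sup>2 / p i / (real n)\<^sup>2 - 2 / real n * c i + p i"
      using n by (simp add: field_simps power2_eq_square)
  qed
  also have "\<dots> = (\<Sum>i=1..m. (c i)\<^sup>2 / p i) / (real n)\<^sup>2 - 2 / real n * (\<Sum>i=1..m. c i) + (\<Sum>i=1..m. p i)"
    by (simp add: sum.distrib sum_subtractf sum_distrib_left sum_divide_distrib)
  \<comment> \<open>The counts sum to \<open>n\<close> and the probabilities to 1, so the last two
    terms give -2 + 1 = -1, which the outer factor \<open>n\<close> turns into
    \<open>- real n\<close>.\<close>
  finally show ?thesis
    unfolding sq sum_c p(2) using n by (simp add: divide_simps power2_eq_square)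
qed

section \<open>The bound in mean for a fixed sample size\<close>

text \<open>The triangle inequality is applied to the decomposition. Only the sum of reciprocals is
  centred; the collision sum is nonnegative and enters through its mean, at a cost of order
  \<open>n\<close>, which is small against the square root of the number of cells in the regime of
  the theorem.\<close>

lemma (in prob_space) pearson_chi_square_L1:
  fixes p :: "nat \<Rightarrow> real" and X :: "'a \<Rightarrow> nat" and Y :: "nat \<Rightarrow> 'a \<Rightarrow> nat"
  assumes n: "n \<ge> 1"
    and X: "random_variable (count_space {1..m}) X"
    and X_pmf: "\<And>i. i \<in> {1..m} \<Longrightarrow> prob {\<omega>\<in>space M. X \<omega> = i} = p i"
    and p_pos: "\<And>i. i \<in> {1..m} \<Longrightarrow> p i > 0"
    and indep: "indep_vars (\<lambda>_. count_space {1..m}) Y {1..n}"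
    and distr: "\<And>k. k \<in> {1..n} \<Longrightarrow>
      distr M (count_space {1..m}) (Y k) = distr M (count_space {1..m}) X"
  shows "integrable M (pearson_chi_square n m p Y)" (is ?int)
    and "expectation (\<lambda>\<omega>. \<bar>pearson_chi_square n m p Y \<omega> - real m\<bar>)
      \<le> sqrt (variance (\<lambda>\<omega>. 1 / p (X \<omega>)) / real n) + 2 * real n" (is ?le)
proof -
  have Y: "random_variable (count_space {1..m}) (Y k)" if "k \<in> {1..n}" for k
    using indep that by (auto simp: indep_vars_def)
  have Y_eq: "expectation (\<lambda>\<omega>. g (Y k \<omega>)) = expectation (\<lambda>\<omega>. g (X \<omega>))"
    if k: "k \<in> {1..n}" for k and g :: "nat \<Rightarrow> real"
    using integral_distr[OF Y[OF k], of g] integral_distr[OF X, of g] distr[OF k] by simp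
  have E_X: "expectation (\<lambda>\<omega>. g (X \<omega>)) = (\<Sum>i=1..m. g i * p i)" for g :: "nat \<Rightarrow> real"
    by (subst expectation_finite_valued[OF _ X]) (auto simp: X_pmf)
  \<comment> \<open>Total mass 1 comes from the mean of the constant 1, since \<open>X\<close> takes
    its values in the cells.\<close>
  have sum_p: "(\<Sum>i=1..m. p i) = 1"
    using E_X[of "\<lambda>_. 1"] by (simp add: prob_space)
  have E_inv: "expectation (\<lambda>\<omega>. 1 / p (X \<omega>)) = real m"
  proof -
    have "(\<Sum>i=1..m. 1 / p i * p i) = (\<Sum>i=1..m. 1)"
      by (intro sum.cong refl) (use p_pos in force)
    then show ?thesis
      by (simp only: E_X[of "\<lambda>i. 1 / p i"]) simp
  qed
  have int_Y: "integrable M (\<lambda>\<omega>. g (Y k \<omega>))" if "k \<in> {1..n}" for k and g :: "nat \<Rightarrow> real"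
    by (rule integrable_finite_valued[OF _ Y[OF that]]) simp

  define S where "S \<omega> = (\<Sum>k=1..n. 1 / p (Y k \<omega>))" for \<omega>
  have indep_inv: "indep_vars (\<lambda>_. borel) (\<lambda>k \<omega>. 1 / p (Y k \<omega>)) {1..n}"
    by (rule indep_vars_compose2[OF indep]) simp
  have S_int: "integrable M S"
    unfolding S_def[abs_def] by (intro Bochner_Integration.integrable_sum int_Y)
  have S_mean: "expectation S = real n * real m"
    unfolding S_def[abs_def]
    by (subst Bochner_Integration.integral_sum)
      (simp_all add: int_Y[of _ "\<lambda>i. 1 / p i"] E_inv Y_eq[of _ "\<lambda>i. 1 / p i"] del: One_nat_def)
  have "integrable M (\<lambda>\<omega>. (S \<omega>)\<^sup>2) \<and> variance S = (\<Sum>k=1..n. variance (\<lambda>\<omega>. 1 / p (Y k \<omega>)))"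
    unfolding S_def[abs_def]
    by (rule variance_sum_indep_vars[OF _ indep_inv]) (auto intro: int_Y)
  \<comment> \<open>The common mean is \<open>m\<close>, so the variance is the mean of a fixed
    function of the observation and depends on its law alone.\<close>
  moreover have "variance (\<lambda>\<omega>. 1 / p (Y k \<omega>)) = variance (\<lambda>\<omega>. 1 / p (X \<omega>))" if "k \<in> {1..n}" for k
    using Y_eq[OF that, of "\<lambda>i. (1 / p i - real m)\<^sup>2"] Y_eq[OF that, of "\<lambda>i. 1 / p i"]
    by (simp add: E_inv)
  ultimately have S_sq: "integrable M (\<lambda>\<omega>. (S \<omega>)\<^sup>2)"
    and S_var: "variance S = real n * variance (\<lambda>\<omega>. 1 / p (X \<omega>))"
    by auto

  define coll where "coll k l \<omega> = of_bool (Y k \<omega> = Y l \<omega>) / p (Y k \<omega>)" for k l \<omega>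
  \<comment> \<open>Two distinct observations share cell \<open>i\<close> with probability
    \<open>p i * p i\<close>; the weight \<open>1 / p i\<close> reduces this to \<open>p i\<close>,
    and these sum to 1.\<close>
  have coll: "integrable M (coll k l) \<and> expectation (coll k l) = 1"
    if k: "k \<in> {1..n}" and l: "l \<in> {1..n} - {k}" for k l
  proof -
    have kl: "k \<noteq> l" using l by auto
    let ?E = "\<lambda>i. {\<omega>\<in>space M. Y k \<omega> = i} \<inter> {\<omega>\<in>space M. Y l \<omega> = i}"
    have prob_Y: "prob {\<omega>\<in>space M. Y j \<omega> = i} = p i" "{\<omega>\<in>space M. Y j \<omega> = i} \<in> events"
      if j: "j \<in> {1..n}" and i: "i \<in> {1..m}" for j i
    proof -
      have *: "{\<omega>\<in>space M. Z \<omega> = i} = Z -` {i} \<inter> space M" for Z :: "'a \<Rightarrow> nat" by auto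
      show "{\<omega>\<in>space M. Y j \<omega> = i} \<in> events"
        unfolding * using i by (intro measurable_sets[OF Y[OF j]]) auto
      show "prob {\<omega>\<in>space M. Y j \<omega> = i} = p i"
        using measure_distr[OF Y[OF j], of "{i}"] measure_distr[OF X, of "{i}"] distr[OF j] i X_pmf[OF i]
        by (simp add: *)
    qed
    have prob_E: "prob (?E i) = p i * p i" if i: "i \<in> {1..m}" for i
    proof -
      have "prob (\<Inter>j\<in>{k,l}. Y j -` {i} \<inter> space M) = (\<Prod>j\<in>{k,l}. prob (Y j -` {i} \<inter> space M))"
        using k l i by (intro indep_varsD[OF indep]) auto
      moreover have "Y j -` {i} \<inter> space M = {\<omega>\<in>space M. Y j \<omega> = i}" for j by auto
      ultimately show ?thesis
        using k l i kl by (simp add: prob_Y)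
    qed
    have meas_E: "?E i \<in> events" if "i \<in> {1..m}" for i
      using prob_Y(2)[OF _ that] k l by auto
    \<comment> \<open>Splitting by the common cell: at a given \<open>\<omega>\<close> only the term
      \<open>i = Y k \<omega>\<close> can be nonzero.\<close>
    have eq: "coll k l \<omega> = (\<Sum>i=1..m. indicator (?E i) \<omega> / p i)" if \<omega>: "\<omega> \<in> space M" for \<omega>
    proof -
      have "Y k \<omega> \<in> {1..m}"
        using measurable_space[OF Y[OF k] \<omega>] by simp
      moreover have "(\<Sum>i=1..m. indicator (?E i) \<omega> / p i) = (\<Sum>i=1..m. if i = Y k \<omega> then coll k l \<omega> else 0)"
        using \<omega> by (intro sum.cong refl) (auto simp: coll_def indicator_def)
      ultimately show ?thesis by simp
    qed
    have int: "integrable M (\<lambda>\<omega>. \<Sum>i=1..m. indicator (?E i) \<omega> / p i)"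
      using meas_E by (intro Bochner_Integration.integrable_sum integrable_divide) (auto simp: less_top[symmetric])
    have "expectation (\<lambda>\<omega>. \<Sum>i=1..m. indicator (?E i) \<omega> / p i) = (\<Sum>i=1..m. prob (?E i) / p i)"
      using meas_E by (subst Bochner_Integration.integral_sum) (auto simp: less_top[symmetric])
    also have "\<dots> = (\<Sum>i=1..m. p i)"
      by (intro sum.cong refl) (use prob_E p_pos in force)
    finally have "expectation (coll k l) = 1"
      using eq sum_p by (simp cong: Bochner_Integration.integral_cong)
    moreover have "integrable M (coll k l)"
      using int eq by (simp cong: Bochner_Integration.integrable_cong)
    ultimately show ?thesis by simp
  qed
  define C where "C \<omega> = (\<Sum>k=1..n. \<Sum>l\<in>{1..n} - {k}. coll k l \<omega>)" for \<omega>
  have C_int: "integrable M C"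
    unfolding C_def[abs_def] using coll by (intro Bochner_Integration.integrable_sum) blast
  \<comment> \<open>There are \<open>n * (n - 1)\<close> ordered pairs of distinct indices, each
    contributing 1.\<close>
  have C_mean: "expectation C = real n * real (n - 1)"
  proof -
    have "expectation C = (\<Sum>k=1..n. \<Sum>l\<in>{1..n} - {k}. expectation (coll k l))"
      unfolding C_def[abs_def] using coll
      by (subst Bochner_Integration.integral_sum, blast)
        (intro sum.cong refl Bochner_Integration.integral_sum, blast)
    also have "\<dots> = (\<Sum>k=1..n. \<Sum>l\<in>{1..n} - {k}. 1)"
      using coll by (intro sum.cong refl) blast
    finally show ?thesis using n by (simp add: of_nat_diff)
  qed
  \<comment> \<open>Membership in the cells, and with it positivity of the weights, is known on
    \<open>space M\<close> only; the pointwise facts that follow carry this restriction.\<close>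
  have Y_in: "Y k \<omega> \<in> {1..m}" if "\<omega> \<in> space M" "k \<in> {1..n}" for \<omega> k
    using measurable_space[OF Y[OF that(2)] that(1)] by simp
  have C_nonneg: "C \<omega> \<ge> 0" if "\<omega> \<in> space M" for \<omega>
    unfolding C_def coll_def
    by (intro sum_nonneg divide_nonneg_nonneg less_imp_le[OF p_pos] Y_in that) auto
  have chi: "pearson_chi_square n m p Y \<omega> = S \<omega> / real n + C \<omega> / real n - real n"
    if "\<omega> \<in> space M" for \<omega>
    unfolding S_def C_def coll_def
    by (rule pearson_chi_square_decomposition) (use n p_pos sum_p Y_in[OF that] in blast)+
  show ?int
    using S_int C_int by (simp add: chi cong: Bochner_Integration.integrable_cong)
  have int_dev: "integrable M (\<lambda>\<omega>. \<bar>S \<omega> - expectation S\<bar>)"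
    using S_int by simp
  have "expectation (\<lambda>\<omega>. \<bar>pearson_chi_square n m p Y \<omega> - real m\<bar>)
      \<le> expectation (\<lambda>\<omega>. \<bar>S \<omega> - expectation S\<bar> / real n + C \<omega> / real n + real n)"
  proof (rule integral_mono)
    show "integrable M (\<lambda>\<omega>. \<bar>pearson_chi_square n m p Y \<omega> - real m\<bar>)"
      using \<open>?int\<close> by simp
    show "integrable M (\<lambda>\<omega>. \<bar>S \<omega> - expectation S\<bar> / real n + C \<omega> / real n + real n)"
      using int_dev C_int by (intro Bochner_Integration.integrable_add integrable_divide) auto
    fix \<omega> assume \<omega>: "\<omega> \<in> space M"
    have "S \<omega> / real n - real m = (S \<omega> - expectation S) / real n"
      using n by (simp add: S_mean diff_divide_distrib)
    then have "\<bar>S \<omega> - expectation S\<bar> / real n = \<bar>S \<omega> / real n - real m\<bar>"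
      by (simp add: abs_divide)
    moreover have "C \<omega> / real n \<ge> 0"
      using C_nonneg[OF \<omega>] by simp
    ultimately show "\<bar>pearson_chi_square n m p Y \<omega> - real m\<bar>
        \<le> \<bar>S \<omega> - expectation S\<bar> / real n + C \<omega> / real n + real n"
      using chi[OF \<omega>] by linarith
  qed
  also have "\<dots> = expectation (\<lambda>\<omega>. \<bar>S \<omega> - expectation S\<bar>) / real n + real (n - 1) + real n"
    using int_dev C_int C_mean n by (simp add: prob_space)
  also have "\<dots> \<le> sqrt (variance S) / real n + real (n - 1) + real n"
    using expectation_abs_deviation_le[OF S_int S_sq] by (intro add_right_mono divide_right_mono) auto
  \<comment> \<open>\<open>S\<close> has \<open>n\<close> times the variance of one reciprocal;
    division by \<open>n\<close> outside the root leaves \<open>1 / n\<close> inside. The remaining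
    \<open>(n - 1) + n\<close> is rounded up to \<open>2 * n\<close>.\<close>
  also have "sqrt (variance S) / real n = sqrt (variance (\<lambda>\<omega>. 1 / p (X \<omega>)) / real n)"
    using n by (simp add: S_var real_sqrt_mult real_sqrt_divide field_simps)
  finally show ?le by simp
qed

section \<open>Normalization and passage to the limit\<close>

theorem mainTheorem3:
  fixes m :: "nat \<Rightarrow> nat"
    and M :: "nat \<Rightarrow> 'a measure"
    and p :: "nat \<Rightarrow> nat \<Rightarrow> real"
    and X :: "nat \<Rightarrow> 'a \<Rightarrow> nat"
    and Xs :: "nat \<Rightarrow> nat \<Rightarrow> 'a \<Rightarrow> nat"
  assumes m_pos: "\<And>n. n \<ge> 1 \<Longrightarrow> m n \<ge> 1"
    and m_tendsto: "filterlim m at_top sequentially"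
    and prob_space: "\<And>n. n \<ge> 1 \<Longrightarrow> prob_space (M n)"
    and X_rv: "\<And>n. n \<ge> 1 \<Longrightarrow> X n \<in> measurable (M n) (count_space {1..m n})"
    and X_pmf: "\<And>n i. n \<ge> 1 \<Longrightarrow> i \<in> {1..m n} \<Longrightarrow>
        measure (M n) {\<omega> \<in> space (M n). X n \<omega> = i} = p n i"
    and p_pos: "\<And>n i. n \<ge> 1 \<Longrightarrow> i \<in> {1..m n} \<Longrightarrow> p n i > 0"
    and Xs_indep: "\<And>n. n \<ge> 1 \<Longrightarrow>
        prob_space.indep_vars (M n) (\<lambda>_. count_space {1..m n}) (Xs n) {1..n}"
    and Xs_distr: "\<And>n k. n \<ge> 1 \<Longrightarrow> k \<in> {1..n} \<Longrightarrow>
        distr (M n) (count_space {1..m n}) (Xs n k) = distr (M n) (count_space {1..m n}) (X n)"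
    and var_tendsto: "(\<lambda>n. 1 / (real (m n) * real n) *
        prob_space.variance (M n) (\<lambda>\<omega>. 1 / p n (X n \<omega>))) \<longlonglongrightarrow> 0"
    and ratio_tendsto: "(\<lambda>n. real n / sqrt (real (m n))) \<longlonglongrightarrow> 0"
  shows "weak_conv_m
     (\<lambda>n. distr (M n) borel
        (\<lambda>\<omega>. (pearson_chi_square n (m n) (p n) (Xs n) \<omega> - real (m n)) / sqrt (2 * real (m n))))
     (return borel 0)"
proof (rule weak_conv_m_return_0_if_L1)
  \<comment> \<open>Nothing is known about \<open>M 0\<close>, so each condition is verified for
    \<open>n \<ge> 1\<close>.\<close>
  show "\<forall>\<^sub>F n in sequentially. prob_space (M n)"
    using eventually_ge_at_top[of 1] by eventually_elim (rule prob_space)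
  have L1: "integrable (M n) (pearson_chi_square n (m n) (p n) (Xs n))"
    "(\<integral>\<omega>. \<bar>pearson_chi_square n (m n) (p n) (Xs n) \<omega> - real (m n)\<bar> \<partial>M n)
      \<le> sqrt (prob_space.variance (M n) (\<lambda>\<omega>. 1 / p n (X n \<omega>)) / real n) + 2 * real n"
    if "n \<ge> 1" for n
    using prob_space.pearson_chi_square_L1[OF prob_space[OF that] that X_rv[OF that] X_pmf[OF that]
        p_pos[OF that] Xs_indep[OF that] Xs_distr[OF that]] by simp_all
  show "\<forall>\<^sub>F n in sequentially. integrable (M n)
     (\<lambda>\<omega>. (pearson_chi_square n (m n) (p n) (Xs n) \<omega> - real (m n)) / sqrt (2 * real (m n)))"
    using eventually_ge_at_top[of 1]
  proof eventually_elim
    case (elim n)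
    interpret prob_space "M n" by (rule prob_space[OF elim])
    show ?case using L1(1)[OF elim] by simp
  qed
  let ?v = "\<lambda>n. 1 / (real (m n) * real n) * prob_space.variance (M n) (\<lambda>\<omega>. 1 / p n (X n \<omega>))"
  let ?r = "\<lambda>n. real n / sqrt (real (m n))"
  let ?E = "\<lambda>n. \<integral>\<omega>. \<bar>(pearson_chi_square n (m n) (p n) (Xs n) \<omega> - real (m n)) / sqrt (2 * real (m n))\<bar> \<partial>M n"
  \<comment> \<open>This is the bound in mean divided by \<open>sqrt (2 * real (m n))\<close>: the
    variance term becomes the root of the first vanishing quantity, the term \<open>2 * n\<close>
    twice the second.\<close>
  have lim: "(\<lambda>n. (sqrt (?v n) + 2 * ?r n) / sqrt 2) \<longlonglongrightarrow> (sqrt 0 + 2 * 0) / sqrt 2"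
    by (intro tendsto_intros var_tendsto ratio_tendsto) simp
  have bound: "\<forall>\<^sub>F n in sequentially. norm (?E n) \<le> (sqrt (?v n) + 2 * ?r n) / sqrt 2"
    using eventually_ge_at_top[of 1]
  proof eventually_elim
    case (elim n)
    let ?V = "prob_space.variance (M n) (\<lambda>\<omega>. 1 / p n (X n \<omega>))"
    have "norm (?E n) = (\<integral>\<omega>. \<bar>pearson_chi_square n (m n) (p n) (Xs n) \<omega> - real (m n)\<bar> \<partial>M n) / sqrt (2 * real (m n))"
      by (simp add: abs_divide)
    also have "\<dots> \<le> (sqrt (?V / real n) + 2 * real n) / sqrt (2 * real (m n))"
      by (intro divide_right_mono L1(2)[OF elim]) simp
    also have "\<dots> = (sqrt (?V / real n) / sqrt (real (m n)) + 2 * ?r n) / sqrt 2"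
      by (simp add: real_sqrt_mult add_divide_distrib mult.commute)
    also have "sqrt (?V / real n) / sqrt (real (m n)) = sqrt (?v n)"
      by (simp add: mult.commute flip: real_sqrt_divide)
    finally show ?case .
  qed
  show "?E \<longlonglongrightarrow> 0"
    by (rule Lim_null_comparison[OF bound]) (use lim in \<open>simp only: real_sqrt_zero mult_zero_right add_0_right div_0\<close>)
qed

end
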